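(* Let $S$ be a domain in $\mathbb{R}^2$, let $a\neq 0$, and let $u,v\in C^1(S)$ satisfy $$\frac{\partial u}{\partial x}=\frac{\partial v}{\partial y}\quad\text{and}\quad \frac{\partial v}{\partial x}=-2\bigl(v^2+y^2+a^2\bigr)^{1/2}\frac{\partial u}{\partial y}. \qquad ( * )$$ Then there exists $f\in C^2(S)$ with $\frac{\partial f}{\partial y}=u$, $\frac{\partial f}{\partial x}=v$ and $$\Bigl(\Bigl(\frac{\partial f}{\partial x}\Bigr)^2+y^2+a^2\Bigr)^{-1/2}\frac{\partial^2 f}{\partial x^2}+2\,\frac{\partial^2 f}{\partial y^2}=0. \qquad ( ** )$$ This $f$ is unique up to addition of a constant, $f\mapsto f+c$. Conversely, all solutions of $( ** )$ yield solutions of $( * )$: if $f\in C^2(S)$ satisfies $( ** )$, then $u=\frac{\partial f}{\partial y}$ and $v=\frac{\partial f}{\partial x}$ satisfy $( * )$.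
   Context: A domain in $\mathbb{R}^2$ is a closed, bounded, contractible subset $S\subset\mathbb{R}^2$ which is a disjoint union $S=S^\circ\cup\partial S$, where the interior $S^\circ$ is a connected open set with $S=\overline{S^\circ}$, and $\partial S=S\setminus S^\circ$ is a compact embedded hypersurface (smooth embedded curve). $C^k(S)$ is the space of continuous functions on $S$ with $k$ continuous derivatives on $S$ (up to the boundary). *)

theory Defs
  imports "HOL-Analysis.Analysis"
begin

text \<open>
  Partial derivatives relative to a set \<open>S\<close> are the coordinates of the Frechet derivative within
  \<open>S\<close>. At interior points these are the usual partial derivatives. The definition also makes sense
  at a boundary point whose horizontal or vertical line meets \<open>S\<close> in that point alone, where
  one-sided difference quotients are not available; on domains with smooth boundary the derivative
  within \<open>S\<close> is unique.
\<close>

definition partial_x :: "(real \<times> real) set \<Rightarrow> (real \<times> real \<Rightarrow> real) \<Rightarrow> real \<times> real \<Rightarrow> real" where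
  "partial_x S f p = frechet_derivative f (at p within S) (1, 0)"

definition partial_y :: "(real \<times> real) set \<Rightarrow> (real \<times> real \<Rightarrow> real) \<Rightarrow> real \<times> real \<Rightarrow> real" where
  "partial_y S f p = frechet_derivative f (at p within S) (0, 1)"

text \<open>
  Only the values on \<open>S\<close> matter. For \<open>S\<close> not open, derivatives are required to exist and to be
  continuous up to the boundary.
\<close>

fun Ck_on :: "nat \<Rightarrow> (real \<times> real) set \<Rightarrow> (real \<times> real \<Rightarrow> real) \<Rightarrow> bool" where
  "Ck_on 0 S f \<longleftrightarrow> continuous_on S f"
| "Ck_on (Suc k) S f \<longleftrightarrow> continuous_on S f \<and> f differentiable_on S \<and>
     Ck_on k S (partial_x S f) \<and> Ck_on k S (partial_y S f)"

definition smooth_map_on :: "(real \<times> real) set \<Rightarrow> (real \<times> real \<Rightarrow> real \<times> real) \<Rightarrow> bool" where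
  "smooth_map_on U \<phi> \<longleftrightarrow>
     (\<forall>k. Ck_on k U (\<lambda>p. fst (\<phi> p)) \<and> Ck_on k U (\<lambda>p. snd (\<phi> p)))"

definition smooth_diffeo :: "(real \<times> real) set \<Rightarrow> (real \<times> real) set \<Rightarrow>
    (real \<times> real \<Rightarrow> real \<times> real) \<Rightarrow> (real \<times> real \<Rightarrow> real \<times> real) \<Rightarrow> bool" where
  "smooth_diffeo U V \<phi> \<psi> \<longleftrightarrow> open U \<and> open V \<and> homeomorphism U V \<phi> \<psi> \<and>
     smooth_map_on U \<phi> \<and> smooth_map_on V \<psi>"

text \<open>Embedded one-dimensional submanifolds of the plane without boundary, by slice charts.\<close>

definition smooth_embedded_curve :: "(real \<times> real) set \<Rightarrow> bool" where
  "smooth_embedded_curve M \<longleftrightarrow>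
     (\<forall>p\<in>M. \<exists>U V \<phi> \<psi>. p \<in> U \<and> smooth_diffeo U V \<phi> \<psi> \<and>
        \<phi> ` (M \<inter> U) = {q \<in> V. snd q = 0})"

text \<open>
  Nonemptiness is part of the usual meaning of contractibility, whereas the library's
  \<^const>\<open>contractible\<close> holds of the empty set.
\<close>

definition plane_domain :: "(real \<times> real) set \<Rightarrow> bool" where
  "plane_domain S \<longleftrightarrow> closed S \<and> bounded S \<and> contractible S \<and> S \<noteq> {} \<and>
     connected (interior S) \<and> S = closure (interior S) \<and>
     compact (S - interior S) \<and> smooth_embedded_curve (S - interior S)"

definition first_order_system ::
    "(real \<times> real) set \<Rightarrow> real \<Rightarrow> (real \<times> real \<Rightarrow> real) \<Rightarrow> (real \<times> real \<Rightarrow> real) \<Rightarrow> bool" where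
  "first_order_system S a u v \<longleftrightarrow>
     (\<forall>(x, y)\<in>S. partial_x S u (x, y) = partial_y S v (x, y) \<and>
        partial_x S v (x, y) =
          - 2 * ((v (x, y))\<^sup>2 + y\<^sup>2 + a\<^sup>2) powr (1/2) * partial_y S u (x, y))"

definition second_order_equation ::
    "(real \<times> real) set \<Rightarrow> real \<Rightarrow> (real \<times> real \<Rightarrow> real) \<Rightarrow> bool" where
  "second_order_equation S a f \<longleftrightarrow>
     (\<forall>(x, y)\<in>S.
        ((partial_x S f (x, y))\<^sup>2 + y\<^sup>2 + a\<^sup>2) powr (-1/2) * partial_x S (partial_x S f) (x, y)
        + 2 * partial_y S (partial_y S f) (x, y) = 0)"

definition is_potential_solution :: "(real \<times> real) set \<Rightarrow> real \<Rightarrow>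
    (real \<times> real \<Rightarrow> real) \<Rightarrow> (real \<times> real \<Rightarrow> real) \<Rightarrow> (real \<times> real \<Rightarrow> real) \<Rightarrow> bool" where
  "is_potential_solution S a u v f \<longleftrightarrow> Ck_on 2 S f \<and>
     (\<forall>p\<in>S. partial_y S f p = u p \<and> partial_x S f p = v p) \<and>
     second_order_equation S a f"

end

theory Submission
  imports Defs "HOL-Complex_Analysis.Complex_Analysis"
begin

text \<open>
  Write \<open>F = (v, u)\<close>. The first equation of the system says that the field \<open>F\<close> is closed, and a
  function \<open>f\<close> with gradient \<open>F\<close> turns the second equation into the second-order equation, because
  \<open>v\<^sup>2 + y\<^sup>2 + a\<^sup>2\<close> is positive. So the content is the existence of a potential of \<open>F\<close> whose
  derivative is \<open>F\<close> up to the boundary, and, for the converse, the equality of mixed partial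
  derivatives up to the boundary.

  Existence has an interior and a boundary part. The complement of the interior of \<open>S\<close> is the
  closure of the complement of \<open>S\<close>, and the latter is connected because \<open>S\<close> is compact and
  contractible (Borsuk). Hence the interior is simply connected. A Riemann map to the disc pulls a
  closed field back to a closed field on a convex set, where integration along rays gives a
  potential (\<open>closed_field_has_potential_plane\<close>). Near a boundary point the slice charts straighten
  \<open>S\<close> to a closed box with the boundary on one of its sides. A function on an open box
  whose gradient extends continuously to the closed box is Lipschitz, hence extends as well, and the
  mean value inequality shows that the extension has the extended gradient as its derivative
  (\<open>gradient_extends_to_closure\<close>). The local extensions agree, since all of them are limits of the
  same interior potential.

  The same charts show that a derivative within \<open>S\<close> is unique, so that \<open>partial_x\<close> and \<open>partial_y\<close>
  of the potential really are \<open>v\<close> and \<open>u\<close> at boundary points. The uniqueness of \<open>f\<close> and the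
  converse are interior statements that pass to \<open>S = closure (interior S)\<close> by continuity.
\<close>

section \<open>Potentials of closed fields on open plane sets\<close>

text \<open>
  The Poincare lemma. The candidate \<open>\<integral>\<^sub>0\<^sup>1 A (t z) \<bullet> z dt\<close> is differentiated under the integral
  sign; by the symmetry of \<open>DA\<close> the resulting integrand in direction \<open>w\<close> is the derivative of
  \<open>t (A (t z) \<bullet> w)\<close> with respect to \<open>t\<close>.
\<close>

lemma closed_field_has_potential_convex:
  fixes A :: "'a::euclidean_space \<Rightarrow> 'a"
  assumes U: "open U" "convex U" "0 \<in> U"
    and der: "\<And>z. z \<in> U \<Longrightarrow> (A has_derivative DA z) (at z)"
    and cont: "\<And>w. continuous_on U (\<lambda>z. DA z w)"
    and sym: "\<And>z v w. z \<in> U \<Longrightarrow> DA z v \<bullet> w = DA z w \<bullet> v"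
  shows "\<exists>k. \<forall>z\<in>U. (k has_derivative (\<lambda>w. A z \<bullet> w)) (at z)"
proof -
  define k where "k = (\<lambda>z. integral (cbox 0 (1::real)) (\<lambda>t. A (t *\<^sub>R z) \<bullet> z))"
  \<comment> \<open>the derivative in \<open>z\<close>, in direction \<open>w\<close>, of the integrand at parameter \<open>t\<close>\<close>
  define D where "D = (\<lambda>z t w. DA (t *\<^sub>R z) (t *\<^sub>R w) \<bullet> z + A (t *\<^sub>R z) \<bullet> w)"
  have ray: "t *\<^sub>R z \<in> U" if "z \<in> U" "t \<in> {0..1}" for z and t :: real
    using convexD[OF U(2,3) that(1), of "1 - t" t] that(2) by simp
  have contA: "continuous_on U A"
    using der by (meson continuous_at_imp_continuous_on has_derivative_continuous)
  have lin: "linear (DA z)" if "z \<in> U" for z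
    using der[OF that] has_derivative_linear by blast
  have derz: "((\<lambda>z. A (t *\<^sub>R z) \<bullet> z) has_derivative D z t) (at z within U)"
    if "z \<in> U" "t \<in> {0..1}" for z t
  proof -
    have "((\<lambda>z. A (t *\<^sub>R z)) has_derivative (\<lambda>w. DA (t *\<^sub>R z) (t *\<^sub>R w))) (at z within U)"
      by (rule has_derivative_compose[where f = "\<lambda>z. t *\<^sub>R z", OF _ der[OF ray[OF that]]])
        (auto intro!: derivative_eq_intros)
    from has_derivative_inner[OF this has_derivative_ident]
    show ?thesis unfolding D_def by (simp add: add.commute)
  qed
  have D_blinfun: "blinfun_apply (Blinfun (D z t)) = D z t" if "z \<in> U" "t \<in> {0..1}" for z t
    using bounded_linear_Blinfun_apply has_derivative_bounded_linear[OF derz[OF that]] by blast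
  have D_alt: "D z t w = t * (DA (t *\<^sub>R z) w \<bullet> z) + A (t *\<^sub>R z) \<bullet> w"
    if "z \<in> U" "t \<in> {0..1}" for z t w
    using linear_cmul[OF lin[OF ray[OF that]]] by (simp add: D_def)
  have contD: "continuous_on (U \<times> {0..1}) (\<lambda>p. D (fst p) (snd p) w)" for w
  proof -
    have "continuous_on (U \<times> {0..1})
      (\<lambda>p. snd p * (DA (snd p *\<^sub>R fst p) w \<bullet> fst p) + A (snd p *\<^sub>R fst p) \<bullet> w)"
      by (intro continuous_intros continuous_on_compose2[OF cont] continuous_on_compose2[OF contA])
        (use ray in auto)
    then show ?thesis
      by (rule continuous_on_eq) (use D_alt in auto)
  qed
  have contA_ray: "continuous_on {0..1} (\<lambda>t. A (t *\<^sub>R z) \<bullet> w)" if "z \<in> U" for z w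
    by (intro continuous_intros continuous_on_compose2[OF contA]) (use ray[OF that] in auto)
  have "(k has_derivative (\<lambda>w. A z \<bullet> w)) (at z)" if z: "z \<in> U" for z
  proof -
    have contB: "continuous_on (U \<times> cbox 0 1) (\<lambda>(z, t). Blinfun (D z t))"
    proof (rule continuous_on_blinfun_componentwise)
      fix w :: 'a
      show "continuous_on (U \<times> cbox 0 1) (\<lambda>p. blinfun_apply (case p of (z, t) \<Rightarrow> Blinfun (D z t)) w)"
        by (rule continuous_on_eq[OF contD[of w, folded cbox_interval]]) (auto simp: D_blinfun)
    qed
    have "(k has_derivative integral (cbox 0 1) (\<lambda>t. Blinfun (D z t))) (at z within U)"
      unfolding k_def
    proof (rule leibniz_rule[OF _ _ contB z U(2)])
      show "((\<lambda>x. A (t *\<^sub>R x) \<bullet> x) has_derivative blinfun_apply (Blinfun (D x t))) (at x within U)"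
        if "x \<in> U" "t \<in> cbox 0 1" for x t
        using derz D_blinfun that by auto
      show "(\<lambda>t. A (t *\<^sub>R x) \<bullet> x) integrable_on cbox 0 1" if "x \<in> U" for x
        using contA_ray[OF that] by (auto intro: integrable_continuous_real)
    qed
    moreover have "blinfun_apply (integral (cbox 0 1) (\<lambda>t. Blinfun (D z t))) w = A z \<bullet> w" for w
    proof -
      have ray_cont: "continuous_on (cbox 0 1) (\<lambda>t::real. (z, t))"
        by (intro continuous_intros)
      have ray_sub: "(\<lambda>t::real. (z, t)) ` cbox 0 1 \<subseteq> U \<times> cbox 0 1"
        using z by auto
      have "continuous_on (cbox 0 1) (\<lambda>t. Blinfun (D z t))"
        using continuous_on_compose2[OF contB ray_cont ray_sub] by simp
      then have "blinfun_apply (integral (cbox 0 1) (\<lambda>t. Blinfun (D z t))) w =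
          integral (cbox 0 1) (\<lambda>t. blinfun_apply (Blinfun (D z t)) w)"
        by (intro blinfun_apply_integral integrable_continuous)
      also have "\<dots> = integral {0..1} (\<lambda>t. D z t w)"
        unfolding cbox_interval using D_blinfun z by (intro Henstock_Kurzweil_Integration.integral_cong) auto
      also have "\<dots> = A z \<bullet> w"
      proof -
        have "((\<lambda>t. t * (A (t *\<^sub>R z) \<bullet> w)) has_vector_derivative D z t w) (at t within {0..1})"
          if t: "t \<in> {0..1}" for t
        proof -
          have "((\<lambda>t. A (t *\<^sub>R z)) has_derivative (\<lambda>s. DA (t *\<^sub>R z) (s *\<^sub>R z))) (at t within {0..1})"
            by (rule has_derivative_compose[where f = "\<lambda>t. t *\<^sub>R z", OF _ der[OF ray[OF z t]]])
              (auto intro!: derivative_eq_intros)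
          then have "((\<lambda>t. t * (A (t *\<^sub>R z) \<bullet> w)) has_derivative
              (\<lambda>s. t * (DA (t *\<^sub>R z) (s *\<^sub>R z) \<bullet> w) + s * (A (t *\<^sub>R z) \<bullet> w))) (at t within {0..1})"
            by (auto intro!: derivative_eq_intros)
          moreover have "(\<lambda>s. t * (DA (t *\<^sub>R z) (s *\<^sub>R z) \<bullet> w) + s * (A (t *\<^sub>R z) \<bullet> w)) =
              (\<lambda>s. s *\<^sub>R D z t w)"
            using linear_cmul[OF lin[OF ray[OF z t]]] sym[OF ray[OF z t], of z w]
            by (auto simp: D_alt[OF z t] algebra_simps)
          ultimately show ?thesis by (simp add: has_vector_derivative_def)
        qed
        from fundamental_theorem_of_calculus[OF _ this] show ?thesis
          by (intro integral_unique) simp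
      qed
      finally show ?thesis .
    qed
    ultimately show ?thesis
      using at_within_open[OF z U(1)] by (metis (no_types, lifting) ext)
  qed
  then show ?thesis by blast
qed

text \<open>
  If \<open>g\<close> maps the disc biholomorphically onto \<open>T\<close>, the pullback of the form \<open>F \<bullet> dz\<close> under \<open>g\<close>
  is represented by the field \<open>F (g z) * cnj (g' z)\<close>. It is closed again, and its potential is
  transported back by the inverse of \<open>g\<close>.
\<close>

lemma closed_field_has_potential_complex:
  fixes F :: "complex \<Rightarrow> complex"
  assumes T: "open T" "simply_connected T"
    and der: "\<And>z. z \<in> T \<Longrightarrow> (F has_derivative DF z) (at z)"
    and cont: "\<And>w. continuous_on T (\<lambda>z. DF z w)"
    and sym: "\<And>z v w. z \<in> T \<Longrightarrow> DF z v \<bullet> w = DF z w \<bullet> v"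
  shows "\<exists>f. \<forall>z\<in>T. (f has_derivative (\<lambda>w. F z \<bullet> w)) (at z)"
proof -
  consider "T = {}" | "T = UNIV" | h g where "h holomorphic_on T" "g holomorphic_on ball 0 1"
      "\<forall>z\<in>T. h z \<in> ball 0 1 \<and> g (h z) = z" "\<forall>z\<in>ball 0 1. g z \<in> T \<and> h (g z) = z"
    using Riemann_mapping_theorem[of T] T by blast
  then show ?thesis
  proof cases
    case 1
    then show ?thesis by simp
  next
    case 2
    then show ?thesis
      using closed_field_has_potential_convex[OF _ _ _ der cont sym] by auto
  next
    case 3
    define A where "A = (\<lambda>z. F (g z) * cnj (deriv g z))"
    define DA where "DA = (\<lambda>z w. F (g z) * cnj (deriv (deriv g) z * w) +
        DF (g z) (deriv g z * w) * cnj (deriv g z))"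
    have g': "(g has_field_derivative deriv g z) (at z)" if "z \<in> ball 0 1" for z
      using 3(2) that holomorphic_derivI open_ball by blast
    have hol': "deriv g holomorphic_on ball 0 1"
      using 3(2) by (simp add: holomorphic_deriv)
    have g'': "(deriv g has_field_derivative deriv (deriv g) z) (at z)" if "z \<in> ball 0 1" for z
      using hol' that holomorphic_derivI open_ball by blast
    have cg: "continuous_on (ball 0 1) g" "continuous_on (ball 0 1) (deriv g)"
      "continuous_on (ball 0 1) (deriv (deriv g))"
      using 3(2) hol' by (simp_all add: holomorphic_deriv holomorphic_on_imp_continuous_on)
    have lin: "linear (DF z)" if "z \<in> T" for z
      using der[OF that] has_derivative_linear by blast
    have contF: "continuous_on T F"
      using der by (meson continuous_at_imp_continuous_on has_derivative_continuous)
    \<comment> \<open>continuity of \<open>DF\<close> is known in fixed directions only, and \<open>DA\<close> uses it in the moving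
      direction \<open>g' z * w\<close>\<close>
    have DF_expand: "DF z w = Re w *\<^sub>R DF z 1 + Im w *\<^sub>R DF z \<i>" if "z \<in> T" for z w
    proof -
      have "w = Re w *\<^sub>R 1 + Im w *\<^sub>R \<i>"
        by (simp add: complex_eq_iff)
      then show ?thesis
        by (metis lin[OF that] linear_add linear_cmul)
    qed
    have "\<exists>k. \<forall>z\<in>ball 0 1. (k has_derivative (\<lambda>w. A z \<bullet> w)) (at z)"
    proof (rule closed_field_has_potential_convex[where DA = DA])
      fix z :: complex assume z: "z \<in> ball 0 1"
      then have gz: "g z \<in> T" using 3(4) by blast
      have "((\<lambda>z. F (g z)) has_derivative (\<lambda>w. DF (g z) (deriv g z * w))) (at z)"
        using has_derivative_compose[OF has_field_derivative_imp_has_derivative[OF g'[OF z]] der[OF gz]] .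
      moreover have "((\<lambda>z. cnj (deriv g z)) has_derivative (\<lambda>w. cnj (deriv (deriv g) z * w))) (at z)"
        using has_derivative_compose[OF has_field_derivative_imp_has_derivative[OF g''[OF z]]
          bounded_linear_imp_has_derivative[OF bounded_linear_cnj]] .
      ultimately show "(A has_derivative DA z) (at z)"
        unfolding A_def DA_def by (rule has_derivative_mult)
      fix v w :: complex
      have "DA z v \<bullet> w = (F (g z) * cnj (deriv (deriv g) z * v)) \<bullet> w
          + DF (g z) (deriv g z * v) \<bullet> (deriv g z * w)" for v w
        by (simp add: DA_def inner_complex_def algebra_simps)
      note expand = this
      have "(F (g z) * cnj (deriv (deriv g) z * v)) \<bullet> w = (F (g z) * cnj (deriv (deriv g) z * w)) \<bullet> v"
        by (simp add: inner_complex_def algebra_simps)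
      then show "DA z v \<bullet> w = DA z w \<bullet> v"
        unfolding expand using sym[OF gz] by simp
    next
      fix w :: complex
      have DFg: "continuous_on (ball 0 1) (\<lambda>z. DF (g z) e)" for e
        by (rule continuous_on_compose2[OF cont cg(1)]) (use 3(4) in blast)
      have Fg: "continuous_on (ball 0 1) (\<lambda>z. F (g z))"
        by (rule continuous_on_compose2[OF contF cg(1)]) (use 3(4) in blast)
      have "continuous_on (ball 0 1) (\<lambda>z. F (g z) * cnj (deriv (deriv g) z * w) +
          (Re (deriv g z * w) *\<^sub>R DF (g z) 1 + Im (deriv g z * w) *\<^sub>R DF (g z) \<i>) * cnj (deriv g z))"
        by (intro continuous_intros cg Fg DFg)
      then show "continuous_on (ball 0 1) (\<lambda>z. DA z w)"
      proof (rule continuous_on_eq)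
        fix z :: complex assume "z \<in> ball 0 1"
        then have "g z \<in> T" using 3(4) by blast
        from DF_expand[OF this, of "deriv g z * w"]
        show "F (g z) * cnj (deriv (deriv g) z * w) + (Re (deriv g z * w) *\<^sub>R DF (g z) 1 +
            Im (deriv g z * w) *\<^sub>R DF (g z) \<i>) * cnj (deriv g z) = DA z w"
          by (simp only: DA_def)
      qed
    qed auto
    then obtain k where k: "(k has_derivative (\<lambda>w. A z \<bullet> w)) (at z)" if "z \<in> ball 0 1" for z
      by blast
    have "((\<lambda>z. k (h z)) has_derivative (\<lambda>w. F z \<bullet> w)) (at z)" if z: "z \<in> T" for z
    proof -
      have hz: "h z \<in> ball 0 1" "g (h z) = z" using 3(3) z by auto
      have h': "(h has_field_derivative deriv h z) (at z)"
        using 3(1) T(1) z holomorphic_derivI by blast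
      have "((\<lambda>z. g (h z)) has_field_derivative deriv g (h z) * deriv h z) (at z)"
        by (rule DERIV_chain2[OF g'[OF hz(1)] h'])
      moreover have "((\<lambda>z. g (h z)) has_field_derivative 1) (at z)"
        by (rule has_field_derivative_transform_within_open[OF DERIV_ident T(1) z]) (use 3(3) in simp)
      ultimately have one: "deriv g (h z) * deriv h z = 1"
        using DERIV_unique by blast
      have "((\<lambda>z. k (h z)) has_derivative (\<lambda>w. A (h z) \<bullet> (deriv h z * w))) (at z)"
        using has_derivative_compose[OF has_field_derivative_imp_has_derivative[OF h'] k[OF hz(1)]] .
      moreover have "A (h z) \<bullet> (deriv h z * w) = F z \<bullet> w" for w
      proof -
        have "A (h z) \<bullet> (deriv h z * w) = F z \<bullet> (deriv g (h z) * deriv h z * w)"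
          by (simp add: A_def hz inner_complex_def algebra_simps)
        then show ?thesis by (simp add: one)
      qed
      ultimately show ?thesis by simp
    qed
    then show ?thesis by blast
  qed
qed

lemma closed_field_has_potential_plane:
  fixes A :: "real \<times> real \<Rightarrow> real \<times> real"
  assumes U: "open U" "bounded U" "connected U" "connected (- U)"
    and der: "\<And>p. p \<in> U \<Longrightarrow> (A has_derivative DA p) (at p)"
    and cont: "\<And>w. continuous_on U (\<lambda>p. DA p w)"
    and sym: "\<And>p v w. p \<in> U \<Longrightarrow> DA p v \<bullet> w = DA p w \<bullet> v"
  shows "\<exists>f. \<forall>p\<in>U. (f has_derivative (\<lambda>w. A p \<bullet> w)) (at p)"
proof -
  define c :: "real \<times> real \<Rightarrow> complex" where "c = (\<lambda>p. Complex (fst p) (snd p))"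
  define r :: "complex \<Rightarrow> real \<times> real" where "r = (\<lambda>z. (Re z, Im z))"
  have rc: "r (c p) = p" and cr: "c (r z) = z" for p z
    by (simp_all add: c_def r_def)
  have inner_c: "c p \<bullet> c q = p \<bullet> q" for p q
    by (simp add: c_def inner_complex_def inner_prod_def)
  have blr: "bounded_linear r"
    unfolding r_def by (intro bounded_linear_Pair bounded_linear_Re bounded_linear_Im)
  have "linear c"
    by (rule linearI) (simp_all add: c_def complex_eq_iff)
  then have blc: "bounded_linear c"
    by (rule linear_conv_bounded_linear[THEN iffD1])
  define T where "T = c ` U"
  have T_vimage: "T = r -` U"
    unfolding T_def using rc cr by (auto simp: image_iff) metis
  have cT: "c ` (- U) = - T"
    unfolding T_def by (metis bij_image_Compl_eq bij_betw_def inj_on_def rc cr surj_def)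
  have contc: "continuous_on X c" for X
    using blc linear_continuous_on by blast
  have "open T"
    unfolding T_vimage using continuous_open_vimage[OF U(1)] blr linear_continuous_at by blast
  moreover have "bounded T"
    unfolding T_def using bounded_linear_image U(2) blc by blast
  moreover have "connected T"
    unfolding T_def by (rule connected_continuous_image[OF contc U(3)])
  moreover have "connected (- T)"
    unfolding cT[symmetric] by (rule connected_continuous_image[OF contc U(4)])
  ultimately have T: "open T" "simply_connected T"
    using simply_connected_iff_simple by blast+
  have "\<exists>f. \<forall>z\<in>T. (f has_derivative (\<lambda>w. c (A (r z)) \<bullet> w)) (at z)"
  proof (rule closed_field_has_potential_complex[OF T, where DF = "\<lambda>z w. c (DA (r z) (r w))"])
    fix z assume z: "z \<in> T"
    then have rz: "r z \<in> U" by (simp add: T_vimage)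
    show "((\<lambda>z. c (A (r z))) has_derivative (\<lambda>w. c (DA (r z) (r w)))) (at z)"
      by (rule has_derivative_compose[OF has_derivative_compose[OF
          bounded_linear_imp_has_derivative[OF blr] der[OF rz]] bounded_linear_imp_has_derivative[OF blc]])
    fix v w
    show "c (DA (r z) (r v)) \<bullet> w = c (DA (r z) (r w)) \<bullet> v"
      using sym[OF rz, of "r v" "r w"] inner_c cr by metis
  next
    fix w
    show "continuous_on T (\<lambda>z. c (DA (r z) (r w)))"
      by (rule continuous_on_compose2[OF contc[of UNIV]], rule continuous_on_compose2[OF cont])
        (use blr linear_continuous_on T_vimage in auto)
  qed
  then obtain f where f: "(f has_derivative (\<lambda>w. c (A (r z)) \<bullet> w)) (at z)" if "z \<in> T" for z
    by blast
  have "((\<lambda>p. f (c p)) has_derivative (\<lambda>w. A p \<bullet> w)) (at p)" if "p \<in> U" for p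
  proof -
    have "c p \<in> T" using that T_def by blast
    from has_derivative_compose[OF bounded_linear_imp_has_derivative[OF blc] f[OF this]]
    show ?thesis by (simp add: rc inner_c)
  qed
  then show ?thesis by blast
qed

text \<open>
  By Borsuk's separation theorem the complement of \<open>S\<close> is connected, since all maps from a
  contractible set to a sphere are null-homotopic. Its closure is the complement of the interior.
\<close>

lemma connected_complement_interior_contractible:
  fixes S :: "'a::euclidean_space set"
  assumes "compact S" "contractible S" "2 \<le> DIM('a)"
  shows "connected (- interior S)"
proof -
  have "connected (- S)"
    using assms Borsuk_separation_theorem nullhomotopic_from_contractible by metis
  then show ?thesis
    using connected_imp_connected_closure closure_complement by metis
qed

section \<open>Extension of a function along with its gradient\<close>

text \<open>
  For each vector \<open>b\<close>, the function \<open>h x - b \<bullet> x\<close> is Lipschitz on convex sets with a bound for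
  \<open>B - b\<close> as its constant. With \<open>b = 0\<close> this gives the continuous extension; with \<open>b = B x\<close> on
  small balls around \<open>x\<close>, where the constant is small, it gives the derivative at \<open>x\<close>.
\<close>

lemma gradient_extends_to_closure:
  fixes h :: "'a::euclidean_space \<Rightarrow> real"
  assumes K: "compact K" "convex K" "K = closure (interior K)"
    and der: "\<And>x. x \<in> interior K \<Longrightarrow> (h has_derivative (\<lambda>w. B x \<bullet> w)) (at x)"
    and cont: "continuous_on K B"
  shows "\<exists>e. (\<forall>x\<in>interior K. e x = h x) \<and>
             (\<forall>x\<in>K. (e has_derivative (\<lambda>w. B x \<bullet> w)) (at x within K))"
proof -
  have lip: "C-lipschitz_on X (\<lambda>x. h x - b \<bullet> x)"
    if X: "convex X" "X \<subseteq> interior K" and C: "\<And>x. x \<in> X \<Longrightarrow> norm (B x - b) \<le> C" "0 \<le> C" for C X b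
  proof (rule lipschitz_onI)
    fix x y assume "x \<in> X" "y \<in> X"
    have "norm ((h x - b \<bullet> x) - (h y - b \<bullet> y)) \<le> C * norm (x - y)"
    proof (rule differentiable_bound[OF X(1) _ _ \<open>x \<in> X\<close> \<open>y \<in> X\<close>])
      fix x assume x: "x \<in> X"
      then have "(h has_derivative (\<lambda>w. B x \<bullet> w)) (at x within X)"
        using der X(2) has_derivative_at_withinI by blast
      then show "((\<lambda>x. h x - b \<bullet> x) has_derivative (\<lambda>w. (B x - b) \<bullet> w)) (at x within X)"
        by (auto intro!: derivative_eq_intros simp: inner_diff_left)
      show "onorm (\<lambda>w. (B x - b) \<bullet> w) \<le> C"
      proof (rule onorm_le)
        fix w
        have "norm ((B x - b) \<bullet> w) \<le> norm (B x - b) * norm w"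
          using Cauchy_Schwarz_ineq2 by simp
        also have "\<dots> \<le> C * norm w"
          by (intro mult_right_mono C(1) x) simp
        finally show "norm ((B x - b) \<bullet> w) \<le> C * norm w" .
      qed
    qed
    then show "dist (h x - b \<bullet> x) (h y - b \<bullet> y) \<le> C * dist x y"
      by (simp add: dist_norm)
  qed (fact C(2))
  obtain C where C: "\<And>x. x \<in> K \<Longrightarrow> norm (B x) \<le> C" "0 \<le> C"
    using compact_imp_bounded[OF compact_continuous_image[OF cont K(1)]]
    unfolding bounded_pos by (auto intro: less_imp_le)
  have "C-lipschitz_on (interior K) (\<lambda>x. h x - 0 \<bullet> x)"
    using lip[of "interior K" 0 C] C interior_subset by (auto simp: K(2) convex_interior)
  then have "uniformly_continuous_on (interior K) h"
    using lipschitz_on_uniformly_continuous by simp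
  from uniformly_continuous_on_extension_on_closure[OF this]
  obtain e where e: "uniformly_continuous_on K e" "\<And>x. x \<in> interior K \<Longrightarrow> e x = h x"
    unfolding K(3)[symmetric] by metis
  have conte: "continuous_on K e"
    using e(1) uniformly_continuous_imp_continuous by blast
  have "(e has_derivative (\<lambda>w. B x \<bullet> w)) (at x within K)" if x: "x \<in> K" for x
    unfolding has_derivative_within_alt
  proof (intro conjI allI impI)
    show "bounded_linear (\<lambda>w. B x \<bullet> w)"
      by (rule bounded_linear_inner_right)
    fix \<epsilon> :: real assume "0 < \<epsilon>"
    then obtain d where d: "0 < d" "\<And>y. y \<in> K \<Longrightarrow> dist y x < d \<Longrightarrow> dist (B y) (B x) < \<epsilon>"
      using cont x unfolding continuous_on_iff by blast
    define X where "X = ball x d \<inter> interior K"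
    have sub: "ball x d \<inter> K \<subseteq> closure X"
      unfolding X_def using open_Int_closure_subset[of "ball x d" "interior K"] K(3) by auto
    have closK: "closure X \<subseteq> K"
      using K(3) closure_mono[of X "interior K"] unfolding X_def by auto
    have "\<epsilon>-lipschitz_on X (\<lambda>y. h y - B x \<bullet> y)"
    proof (rule lip)
      show "convex X" unfolding X_def by (intro convex_Int convex_ball convex_interior K(2))
      show "norm (B y - B x) \<le> \<epsilon>" if "y \<in> X" for y
        using d(2)[of y] that interior_subset unfolding X_def
        by (force simp: dist_norm norm_minus_commute)
    qed (use \<open>0 < \<epsilon>\<close> X_def in auto)
    then have "\<epsilon>-lipschitz_on X (\<lambda>y. e y - B x \<bullet> y)"
      by (rule lipschitz_on_transform) (use e(2) X_def in auto)
    then have L: "\<epsilon>-lipschitz_on (closure X) (\<lambda>y. e y - B x \<bullet> y)"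
      by (rule lipschitz_on_closure) (intro continuous_intros continuous_on_subset[OF conte closK])
    have "norm (e y - e x - B x \<bullet> (y - x)) \<le> \<epsilon> * norm (y - x)" if "y \<in> K" "norm (y - x) < d" for y
    proof -
      have "x \<in> closure X" "y \<in> closure X"
        using sub x d(1) that by (auto simp: dist_norm norm_minus_commute)
      from lipschitz_onD[OF L this(2,1)] show ?thesis
        by (simp add: dist_norm inner_diff_right algebra_simps)
    qed
    then show "\<exists>d>0. \<forall>y\<in>K. norm (y - x) < d \<longrightarrow> norm (e y - e x - B x \<bullet> (y - x)) \<le> \<epsilon> * norm (y - x)"
      using d(1) by blast
  qed
  then show ?thesis using e(2) by blast
qed

section \<open>Half-box charts at the boundary\<close>

lemma partials_has_derivative:
  assumes "f differentiable (at p within S)"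
  shows "(f has_derivative (\<lambda>w. (partial_x S f p, partial_y S f p) \<bullet> w)) (at p within S)"
proof -
  have D: "(f has_derivative frechet_derivative f (at p within S)) (at p within S)"
    using assms frechet_derivative_works by blast
  then have lin: "linear (frechet_derivative f (at p within S))"
    using has_derivative_linear by blast
  have "frechet_derivative f (at p within S) w = (partial_x S f p, partial_y S f p) \<bullet> w" for w
  proof -
    have "w = fst w *\<^sub>R (1, 0) + snd w *\<^sub>R (0, 1)" by (simp add: prod_eq_iff)
    then have "frechet_derivative f (at p within S) w =
        fst w *\<^sub>R frechet_derivative f (at p within S) (1, 0) +
        snd w *\<^sub>R frechet_derivative f (at p within S) (0, 1)"
      using linear_add[OF lin] linear_cmul[OF lin] by metis
    then show ?thesis by (simp add: partial_x_def partial_y_def inner_prod_def mult.commute)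
  qed
  then show ?thesis using D by (metis (no_types, lifting) ext)
qed

lemma smooth_map_on_imp_C1:
  assumes "open U" "smooth_map_on U \<phi>"
  shows "\<exists>D. (\<forall>p\<in>U. (\<phi> has_derivative D p) (at p)) \<and> (\<forall>w. continuous_on U (\<lambda>p. D p w))"
proof -
  define G1 where "G1 = (\<lambda>p. (partial_x U (\<lambda>p. fst (\<phi> p)) p, partial_y U (\<lambda>p. fst (\<phi> p)) p))"
  define G2 where "G2 = (\<lambda>p. (partial_x U (\<lambda>p. snd (\<phi> p)) p, partial_y U (\<lambda>p. snd (\<phi> p)) p))"
  have "Ck_on (Suc 0) U (\<lambda>p. fst (\<phi> p))" "Ck_on (Suc 0) U (\<lambda>p. snd (\<phi> p))"
    using assms(2) by (auto simp only: smooth_map_on_def)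
  then have d: "(\<lambda>p. fst (\<phi> p)) differentiable_on U" "(\<lambda>p. snd (\<phi> p)) differentiable_on U"
    and c: "continuous_on U G1" "continuous_on U G2"
    unfolding G1_def G2_def by (auto intro!: continuous_intros)
  show ?thesis
  proof (intro exI[of _ "\<lambda>p w. (G1 p \<bullet> w, G2 p \<bullet> w)"] conjI ballI allI)
    fix p assume p: "p \<in> U"
    have "((\<lambda>p. (fst (\<phi> p), snd (\<phi> p))) has_derivative (\<lambda>w. (G1 p \<bullet> w, G2 p \<bullet> w))) (at p within U)"
      unfolding G1_def G2_def using d p
      by (intro has_derivative_Pair partials_has_derivative) (auto simp: differentiable_on_def)
    then show "(\<phi> has_derivative (\<lambda>w. (G1 p \<bullet> w, G2 p \<bullet> w))) (at p)"
      using at_within_open[OF p assms(1)] by simp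
  next
    show "continuous_on U (\<lambda>p. (G1 p \<bullet> w, G2 p \<bullet> w))" for w
      by (intro continuous_intros c)
  qed
qed

text \<open>
  A chart that carries \<open>S\<close> near a boundary point into a closed box and the interior of \<open>S\<close> into
  the open box. A box is used because it is convex, and because the coordinate directions, which
  determine a derivative, can be reached from each of its points.
\<close>

definition half_box_chart :: "(real \<times> real) set \<Rightarrow> (real \<times> real) set \<Rightarrow> real \<times> real \<Rightarrow> real \<times> real \<Rightarrow>
    (real \<times> real \<Rightarrow> real \<times> real) \<Rightarrow> (real \<times> real \<Rightarrow> real \<times> real) \<Rightarrow>
    (real \<times> real \<Rightarrow> real \<times> real \<Rightarrow> real \<times> real) \<Rightarrow>
    (real \<times> real \<Rightarrow> real \<times> real \<Rightarrow> real \<times> real) \<Rightarrow> bool" where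
  "half_box_chart S W a b \<phi> \<psi> D\<phi> D\<psi> \<longleftrightarrow>
     open W \<and> (\<forall>i\<in>Basis. a \<bullet> i < b \<bullet> i) \<and>
     \<phi> ` (S \<inter> W) \<subseteq> cbox a b \<and> \<phi> ` (interior S \<inter> W) \<subseteq> box a b \<and>
     \<psi> ` cbox a b \<subseteq> S \<and> \<psi> ` box a b \<subseteq> interior S \<and> (\<forall>x\<in>W. \<psi> (\<phi> x) = x) \<and>
     (\<forall>x\<in>W. (\<phi> has_derivative D\<phi> x) (at x)) \<and>
     (\<forall>q\<in>cbox a b. (\<psi> has_derivative D\<psi> q) (at q)) \<and>
     (\<forall>w. continuous_on (cbox a b) (\<lambda>q. D\<psi> q w))"

text \<open>
  In a slice chart take a box around the image of \<open>p\<close>. The line \<open>snd q = 0\<close>, which is the image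
  of the boundary of \<open>S\<close>, cuts it into an upper and a lower half. Each half is connected and misses
  the boundary, so it lies in the interior or outside of \<open>S\<close>. They are not both outside,
  because \<open>p\<close> is a limit of interior points, and not both inside, because then \<open>p\<close> would be an
  interior point.
\<close>

lemma boundary_half_box_chart:
  assumes S: "plane_domain S" and p: "p \<in> S - interior S"
  obtains \<phi> \<psi> D\<phi> D\<psi> W a b where "p \<in> W" "half_box_chart S W a b \<phi> \<psi> D\<phi> D\<psi>"
proof -
  note chartI = that
  define M where "M = S - interior S"
  have "smooth_embedded_curve M" "p \<in> M"
    using S p unfolding plane_domain_def M_def by blast+
  then obtain U V \<phi> \<psi> where pU: "p \<in> U" and diffeo: "smooth_diffeo U V \<phi> \<psi>"
    and slice: "\<phi> ` (M \<inter> U) = {q \<in> V. snd q = 0}"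
    unfolding smooth_embedded_curve_def by blast
  have UV: "open U" "open V" and hom: "homeomorphism U V \<phi> \<psi>"
    and smooth: "smooth_map_on U \<phi>" "smooth_map_on V \<psi>"
    using diffeo by (auto simp: smooth_diffeo_def)
  have \<psi>\<phi>: "\<psi> (\<phi> x) = x" "\<phi> x \<in> V" if "x \<in> U" for x
    using hom that by (auto simp: homeomorphism_def)
  have \<phi>\<psi>: "\<phi> (\<psi> q) = q" "\<psi> q \<in> U" if "q \<in> V" for q
    using hom that by (auto simp: homeomorphism_def)
  have cont: "continuous_on U \<phi>" "continuous_on V \<psi>"
    using hom by (auto simp: homeomorphism_def)
  have in_M: "\<psi> q \<in> M \<longleftrightarrow> snd q = 0" if "q \<in> V" for q
  proof
    assume "\<psi> q \<in> M"
    then have "\<phi> (\<psi> q) \<in> \<phi> ` (M \<inter> U)" using \<phi>\<psi>(2)[OF that] by blast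
    then show "snd q = 0" using slice \<phi>\<psi>(1)[OF that] by simp
  next
    assume "snd q = 0"
    then have "q \<in> \<phi> ` (M \<inter> U)" using slice that by blast
    then show "\<psi> q \<in> M" using \<psi>\<phi>(1) by auto
  qed
  have clS: "closed S" "S = closure (interior S)"
    using S unfolding plane_domain_def by blast+
  have frS: "frontier S = M"
    using clS(1) by (simp add: frontier_def M_def)
  obtain D\<phi> where D\<phi>: "\<And>x. x \<in> U \<Longrightarrow> (\<phi> has_derivative D\<phi> x) (at x)"
    using smooth_map_on_imp_C1[OF UV(1) smooth(1)] by metis
  obtain D\<psi> where D\<psi>: "\<And>q. q \<in> V \<Longrightarrow> (\<psi> has_derivative D\<psi> q) (at q)"
    "\<And>w. continuous_on V (\<lambda>q. D\<psi> q w)"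
    using smooth_map_on_imp_C1[OF UV(2) smooth(2)] by metis
  obtain a b where ab: "cbox a b \<subseteq> V" "\<phi> p \<in> box a b"
    by (rule open_contains_cbox[OF UV(2) \<psi>\<phi>(2)[OF pU]])
  have box_iff: "q \<in> box c d \<longleftrightarrow> fst c < fst q \<and> fst q < fst d \<and> snd c < snd q \<and> snd q < snd d"
    for q c d :: "real \<times> real"
    by (cases q; cases c; cases d) (auto simp: box_def Basis_prod_def)
  have cbox_iff: "q \<in> cbox c d \<longleftrightarrow> fst c \<le> fst q \<and> fst q \<le> fst d \<and> snd c \<le> snd q \<and> snd q \<le> snd d"
    for q c d :: "real \<times> real"
    by (cases q; cases c; cases d) (auto simp: cbox_def Basis_prod_def)
  define W where "W = U \<inter> \<phi> -` box a b"
  have W: "open W" "p \<in> W"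
    unfolding W_def using continuous_open_preimage[OF cont(1) UV(1)] pU ab(2) by auto
  have "snd (\<phi> p) = 0"
    using in_M[OF \<psi>\<phi>(2)[OF pU]] \<psi>\<phi>(1)[OF pU] \<open>p \<in> M\<close> by simp
  then have ab_less: "fst a < fst b" "snd a < 0" "0 < snd b"
    using ab(2) by (auto simp: box_iff)
  define up where "up = box (fst a, 0) b"
  define down where "down = box a (fst b, 0)"
  have up_down: "up \<subseteq> V" "down \<subseteq> V" "up \<union> down \<subseteq> box a b"
    using ab(1) ab_less by (auto simp: up_def down_def box_iff cbox_iff subset_iff)
  \<comment> \<open>a connected set that meets \<open>S\<close> and its complement would meet the frontier of \<open>S\<close>\<close>
  have side: "\<psi> ` Q \<subseteq> interior S \<or> \<psi> ` Q \<inter> S = {}"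
    if Q: "connected Q" "Q \<subseteq> V" "\<And>q. q \<in> Q \<Longrightarrow> snd q \<noteq> 0" for Q
  proof -
    have "\<psi> ` Q \<inter> M = {}" using in_M Q(2,3) by blast
    moreover have "connected (\<psi> ` Q)"
      using Q cont(2) connected_continuous_image continuous_on_subset by blast
    ultimately have "\<psi> ` Q \<inter> S = {} \<or> \<psi> ` Q - S = {}"
      using connected_Int_frontier frS by metis
    then show ?thesis
      using \<open>\<psi> ` Q \<inter> M = {}\<close> M_def by blast
  qed
  have side_up: "\<psi> ` up \<subseteq> interior S \<or> \<psi> ` up \<inter> S = {}"
    by (rule side) (use up_down in \<open>auto simp: up_def box_iff intro: convex_connected convex_box\<close>)
  have side_down: "\<psi> ` down \<subseteq> interior S \<or> \<psi> ` down \<inter> S = {}"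
    by (rule side) (use up_down in \<open>auto simp: down_def box_iff intro: convex_connected convex_box\<close>)
  have W_split: "\<phi> x \<in> up \<or> \<phi> x \<in> down \<or> x \<in> M" if "x \<in> W" for x
    using that in_M[of "\<phi> x"] \<psi>\<phi>[of x] by (auto simp: W_def up_def down_def box_iff)
  have not_both: "\<not> (\<psi> ` up \<subseteq> interior S \<and> \<psi> ` down \<subseteq> interior S)"
  proof
    assume *: "\<psi> ` up \<subseteq> interior S \<and> \<psi> ` down \<subseteq> interior S"
    have "W \<subseteq> S"
    proof
      fix x assume "x \<in> W"
      then show "x \<in> S"
        using W_split[of x] * \<psi>\<phi>(1)[of x] interior_subset[of S] M_def W_def
        by (metis DiffD1 IntD1 image_subset_iff subsetD)
    qed
    then show False
      using W interior_maximal p by blast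
  qed
  have not_neither: "\<not> (\<psi> ` up \<inter> S = {} \<and> \<psi> ` down \<inter> S = {})"
  proof
    assume *: "\<psi> ` up \<inter> S = {} \<and> \<psi> ` down \<inter> S = {}"
    have "p \<in> closure (interior S)" using clS(2) p by auto
    then obtain x where x: "x \<in> interior S" "x \<in> W"
      using W open_Int_closure_eq_empty by (metis IntI disjoint_iff)
    then show False
      using W_split[OF x(2)] * \<psi>\<phi>(1)[of x] interior_subset[of S] unfolding M_def W_def
      by (metis DiffD2 IntD1 IntI emptyE image_eqI subsetD)
  qed
  \<comment> \<open>both halves are treated alike: \<open>Q\<close> is the half that \<open>\<psi>\<close> maps into the interior\<close>
  have finish: thesis
    if Q: "Q = box c d" "fst c < fst d \<and> snd c < snd d" "cbox c d \<subseteq> V" "\<psi> ` Q \<subseteq> interior S"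
      and W_Q: "\<And>x. x \<in> W \<Longrightarrow> x \<in> S \<Longrightarrow> \<phi> x \<in> Q \<or> x \<in> M"
      and line: "\<And>q. q \<in> box a b \<Longrightarrow> snd q = 0 \<Longrightarrow> q \<in> cbox c d" for Q c d
  proof (rule chartI[OF W(2)])
    have sides: "\<forall>i\<in>Basis. c \<bullet> i < d \<bullet> i"
      using Q(2) by (auto simp: Basis_prod_def inner_prod_def)
    moreover have "\<phi> ` (S \<inter> W) \<subseteq> cbox c d"
    proof (rule image_subsetI)
      fix x assume "x \<in> S \<inter> W"
      then have x: "x \<in> S" "x \<in> W" by auto
      then have "\<phi> x \<in> box a b" "x \<in> U" by (auto simp: W_def)
      then show "\<phi> x \<in> cbox c d"
        using W_Q[OF x(2,1)] line[of "\<phi> x"] in_M[of "\<phi> x"] \<psi>\<phi>[of x] Q(1) box_subset_cbox by auto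
    qed
    moreover have "\<phi> ` (interior S \<inter> W) \<subseteq> box c d"
      using W_Q interior_subset[of S] Q(1) M_def by blast
    moreover have "\<psi> ` cbox c d \<subseteq> S"
    proof -
      have ne: "box c d \<noteq> {}"
        using sides by (simp add: box_ne_empty)
      have "\<psi> ` closure (box c d) \<subseteq> S"
        by (rule image_closure_subset)
          (use Q clS(1) interior_subset[of S] closure_box[OF ne] continuous_on_subset[OF cont(2)] in auto)
      then show ?thesis
        by (simp add: closure_box[OF ne])
    qed
    moreover have "continuous_on (cbox c d) (\<lambda>q. D\<psi> q w)" for w
      using D\<psi>(2) Q(3) by (rule continuous_on_subset)
    ultimately show "half_box_chart S W c d \<phi> \<psi> D\<phi> D\<psi>"
      unfolding half_box_chart_def
      using W(1) Q(1,3,4) \<psi>\<phi>(1) D\<phi>(1) D\<psi>(1) unfolding W_def by (intro conjI ballI allI) auto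
  qed
  show thesis
  proof (cases "\<psi> ` up \<subseteq> interior S")
    case True
    then have down: "\<psi> ` down \<inter> S = {}" using not_both side_down by blast
    show thesis
    proof (rule finish[OF up_def _ _ True])
      fix x assume "x \<in> W" "x \<in> S"
      then show "\<phi> x \<in> up \<or> x \<in> M"
        using W_split[of x] down \<psi>\<phi>(1)[of x] W_def by (metis IntD1 IntI emptyE image_eqI)
    next
      have "cbox (fst a, 0) b \<subseteq> cbox a b"
        using ab_less by (auto simp: cbox_iff)
      then show "cbox (fst a, 0) b \<subseteq> V"
        using ab(1) by blast
    next
      fix q assume "q \<in> box a b" "snd q = 0"
      then show "q \<in> cbox (fst a, 0) b"
        by (simp add: box_iff cbox_iff)
    qed (use ab_less in simp)
  next
    case False
    then have up: "\<psi> ` up \<inter> S = {}" using side_up by blast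
    then have down: "\<psi> ` down \<subseteq> interior S" using not_neither side_down by blast
    show thesis
    proof (rule finish[OF down_def _ _ down])
      fix x assume "x \<in> W" "x \<in> S"
      then show "\<phi> x \<in> down \<or> x \<in> M"
        using W_split[of x] up \<psi>\<phi>(1)[of x] W_def by (metis IntD1 IntI emptyE image_eqI)
    next
      have "cbox a (fst b, 0) \<subseteq> cbox a b"
        using ab_less by (auto simp: cbox_iff)
      then show "cbox a (fst b, 0) \<subseteq> V"
        using ab(1) by blast
    next
      fix q assume "q \<in> box a b" "snd q = 0"
      then show "q \<in> cbox a (fst b, 0)"
        by (simp add: box_iff cbox_iff)
    qed (use ab_less in simp)
  qed
qed

text \<open>
  Composed with a half-box chart, two derivatives of \<open>f\<close> become derivatives within a closed box,
  where they agree; the derivative of the chart is invertible.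
\<close>

lemma has_derivative_within_plane_domain_unique:
  assumes S: "plane_domain S" and p: "p \<in> S"
    and f: "(f has_derivative D1) (at p within S)" "(f has_derivative D2) (at p within S)"
  shows "D1 = D2"
proof (cases "p \<in> interior S")
  case True
  then show ?thesis
    using f has_derivative_unique by (metis at_within_interior)
next
  case False
  with p have "p \<in> S - interior S" by blast
  then obtain \<phi> \<psi> D\<phi> D\<psi> W a b where pW: "p \<in> W" and chart: "half_box_chart S W a b \<phi> \<psi> D\<phi> D\<psi>"
    by (rule boundary_half_box_chart[OF S])
  have W: "open W" "\<And>i. i \<in> Basis \<Longrightarrow> a \<bullet> i < b \<bullet> i" "\<phi> ` (S \<inter> W) \<subseteq> cbox a b" "\<psi> ` cbox a b \<subseteq> S"
    and inv: "\<And>x. x \<in> W \<Longrightarrow> \<psi> (\<phi> x) = x"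
    and D: "\<And>x. x \<in> W \<Longrightarrow> (\<phi> has_derivative D\<phi> x) (at x)"
      "\<And>q. q \<in> cbox a b \<Longrightarrow> (\<psi> has_derivative D\<psi> q) (at q)"
    using chart unfolding half_box_chart_def by blast+
  have q: "\<phi> p \<in> cbox a b" using W(3) pW p by blast
  have comp: "((\<lambda>q. f (\<psi> q)) has_derivative (\<lambda>w. D (D\<psi> (\<phi> p) w))) (at (\<phi> p) within cbox a b)"
    if "(f has_derivative D) (at p within S)" for D
  proof -
    have "(\<psi> has_derivative D\<psi> (\<phi> p)) (at (\<phi> p) within cbox a b)"
      using D(2)[OF q] has_derivative_at_withinI by blast
    moreover have "(f has_derivative D) (at (\<psi> (\<phi> p)) within \<psi> ` cbox a b)"
      using has_derivative_subset[OF that W(4)] inv[OF pW] by simp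
    ultimately show ?thesis
      by (rule has_derivative_in_compose)
  qed
  have eq: "(\<lambda>w. D1 (D\<psi> (\<phi> p) w)) = (\<lambda>w. D2 (D\<psi> (\<phi> p) w))"
    by (rule frechet_derivative_unique_within_closed_interval[OF W(2) q comp[OF f(1)] comp[OF f(2)]])
  have "((\<lambda>x. \<psi> (\<phi> x)) has_derivative (\<lambda>w. D\<psi> (\<phi> p) (D\<phi> p w))) (at p)"
    by (rule has_derivative_compose[OF D(1)[OF pW] D(2)[OF q]])
  moreover have "((\<lambda>x. \<psi> (\<phi> x)) has_derivative (\<lambda>w. w)) (at p)"
    by (rule has_derivative_transform_within_open[OF has_derivative_ident W(1) pW]) (use inv in simp)
  ultimately have "D\<psi> (\<phi> p) (D\<phi> p w) = w" for w
    using has_derivative_unique by metis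
  then show ?thesis
    using eq by (metis ext)
qed

section \<open>Potentials up to the boundary\<close>

text \<open>
  In a half-box chart the gradient of \<open>f \<circ> \<psi>\<close> extends continuously to the closed box, because \<open>F\<close>
  and the derivative of \<open>\<psi>\<close> do. So \<open>f \<circ> \<psi>\<close> extends, and \<open>\<phi>\<close> carries the extension back to \<open>S\<close>.
\<close>

lemma potential_extends_locally:
  assumes S: "plane_domain S" and p: "p \<in> S"
    and F: "continuous_on S F"
    and f: "\<And>x. x \<in> interior S \<Longrightarrow> (f has_derivative (\<lambda>w. F x \<bullet> w)) (at x)"
  shows "\<exists>W e. open W \<and> p \<in> W \<and> (\<forall>x\<in>W \<inter> interior S. e x = f x) \<and>
    (\<forall>x\<in>W \<inter> S. (e has_derivative (\<lambda>w. F x \<bullet> w)) (at x within S))"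
proof (cases "p \<in> interior S")
  case True
  then show ?thesis
    using f by (intro exI[of _ "interior S"] exI[of _ f]) (auto intro: has_derivative_at_withinI)
next
  case False
  with p have "p \<in> S - interior S" by blast
  then obtain \<phi> \<psi> D\<phi> D\<psi> W a b where pW: "p \<in> W" and chart: "half_box_chart S W a b \<phi> \<psi> D\<phi> D\<psi>"
    by (rule boundary_half_box_chart[OF S])
  have W: "open W" "\<forall>i\<in>Basis. a \<bullet> i < b \<bullet> i" "\<phi> ` (S \<inter> W) \<subseteq> cbox a b"
      "\<phi> ` (interior S \<inter> W) \<subseteq> box a b" "\<psi> ` cbox a b \<subseteq> S" "\<psi> ` box a b \<subseteq> interior S"
    and inv: "\<And>x. x \<in> W \<Longrightarrow> \<psi> (\<phi> x) = x"
    and D\<phi>: "\<And>x. x \<in> W \<Longrightarrow> (\<phi> has_derivative D\<phi> x) (at x)"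
    and D\<psi>: "\<And>q. q \<in> cbox a b \<Longrightarrow> (\<psi> has_derivative D\<psi> q) (at q)"
    and cont: "\<And>w. continuous_on (cbox a b) (\<lambda>q. D\<psi> q w)"
    using chart unfolding half_box_chart_def by blast+
  \<comment> \<open>the gradient of \<open>f \<circ> \<psi>\<close>, written so that it makes sense on the closed box\<close>
  define B where "B = (\<lambda>q. (F (\<psi> q) \<bullet> D\<psi> q (1, 0), F (\<psi> q) \<bullet> D\<psi> q (0, 1)))"
  have B_inner: "B q \<bullet> w = F (\<psi> q) \<bullet> D\<psi> q w" if "q \<in> cbox a b" for q w
  proof -
    have lin: "linear (D\<psi> q)"
      using D\<psi>[OF that] has_derivative_linear by blast
    have "w = fst w *\<^sub>R (1, 0) + snd w *\<^sub>R (0, 1)" by (simp add: prod_eq_iff)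
    then have "D\<psi> q w = fst w *\<^sub>R D\<psi> q (1, 0) + snd w *\<^sub>R D\<psi> q (0, 1)"
      using linear_add[OF lin] linear_cmul[OF lin] by metis
    then show ?thesis
      by (simp add: B_def inner_prod_def[of "(_, _)"] inner_add_right mult.commute)
  qed
  have cont_\<psi>: "continuous_on (cbox a b) \<psi>"
    using D\<psi> by (meson continuous_at_imp_continuous_on has_derivative_continuous)
  have cont_F\<psi>: "continuous_on (cbox a b) (\<lambda>q. F (\<psi> q))"
    by (rule continuous_on_compose2[OF F cont_\<psi> W(5)])
  have contB: "continuous_on (cbox a b) B"
    unfolding B_def by (intro continuous_intros cont_F\<psi> cont)
  have ne: "box a b \<noteq> {}" using W(2) by (simp add: box_ne_empty)
  have "\<exists>e. (\<forall>q\<in>interior (cbox a b). e q = f (\<psi> q)) \<and>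
      (\<forall>q\<in>cbox a b. (e has_derivative (\<lambda>w. B q \<bullet> w)) (at q within cbox a b))"
  proof (rule gradient_extends_to_closure[OF compact_cbox convex_box(1) _ _ contB])
    show "cbox a b = closure (interior (cbox a b))"
      by (simp add: interior_cbox closure_box[OF ne])
    fix q assume "q \<in> interior (cbox a b)"
    then have q: "q \<in> box a b" "q \<in> cbox a b"
      using interior_cbox box_subset_cbox by blast+
    then have "\<psi> q \<in> interior S" using W(6) by blast
    from has_derivative_compose[OF D\<psi>[OF q(2)] f[OF this]]
    show "((\<lambda>q. f (\<psi> q)) has_derivative (\<lambda>w. B q \<bullet> w)) (at q)"
      by (simp add: B_inner[OF q(2)])
  qed
  then obtain e where e: "\<And>q. q \<in> box a b \<Longrightarrow> e q = f (\<psi> q)"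
    "\<And>q. q \<in> cbox a b \<Longrightarrow> (e has_derivative (\<lambda>w. B q \<bullet> w)) (at q within cbox a b)"
    by (auto simp: interior_cbox)
  have "((\<lambda>x. e (\<phi> x)) has_derivative (\<lambda>w. F x \<bullet> w)) (at x within S)" if x: "x \<in> W" "x \<in> S" for x
  proof -
    have q: "\<phi> x \<in> cbox a b" using W(3) x by blast
    have "((\<lambda>x. \<psi> (\<phi> x)) has_derivative (\<lambda>w. D\<psi> (\<phi> x) (D\<phi> x w))) (at x)"
      by (rule has_derivative_compose[OF D\<phi>[OF x(1)] D\<psi>[OF q]])
    moreover have "((\<lambda>x. \<psi> (\<phi> x)) has_derivative (\<lambda>w. w)) (at x)"
      by (rule has_derivative_transform_within_open[OF has_derivative_ident W(1) x(1)]) (use inv in simp)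
    ultimately have id: "D\<psi> (\<phi> x) (D\<phi> x w) = w" for w
      using has_derivative_unique by metis
    have "((\<lambda>x. e (\<phi> x)) has_derivative (\<lambda>w. B (\<phi> x) \<bullet> D\<phi> x w)) (at x within S \<inter> W)"
      using has_derivative_in_compose[OF has_derivative_at_withinI[OF D\<phi>[OF x(1)]]
        has_derivative_subset[OF e(2)[OF q] W(3)]] .
    moreover have "at x within S \<inter> W = at x within S"
      by (rule at_within_nhd[OF x(1) W(1)]) auto
    ultimately show ?thesis
      by (simp add: B_inner[OF q] id inv[OF x(1)])
  qed
  moreover have "e (\<phi> x) = f x" if "x \<in> W" "x \<in> interior S" for x
    using e(1)[of "\<phi> x"] inv[OF that(1)] W(4) that by auto
  ultimately show ?thesis
    using W(1) pW by (intro exI[of _ W] exI[of _ "\<lambda>x. e (\<phi> x)"]) auto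
qed

text \<open>
  The values of a local extension are forced: they are the limits of \<open>f\<close> from the interior. These
  limits therefore define a global extension that agrees with each local one.
\<close>

lemma glue_local_extensions:
  fixes f :: "'a::euclidean_space \<Rightarrow> 'b::real_normed_vector"
  assumes S: "S = closure (interior S)"
    and ext: "\<And>p. p \<in> S \<Longrightarrow> \<exists>W e. open W \<and> p \<in> W \<and> (\<forall>x\<in>W \<inter> interior S. e x = f x) \<and>
      (\<forall>x\<in>W \<inter> S. (e has_derivative D x) (at x within S))"
  shows "\<exists>g. \<forall>x\<in>S. (g has_derivative D x) (at x within S)"
proof (intro exI ballI)
  define g where "g = (\<lambda>x. Lim (at x within interior S) f)"
  fix p assume p: "p \<in> S"
  obtain W e where W: "open W" "p \<in> W" and ef: "\<And>x. x \<in> W \<Longrightarrow> x \<in> interior S \<Longrightarrow> e x = f x"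
    and e: "\<And>x. x \<in> W \<Longrightarrow> x \<in> S \<Longrightarrow> (e has_derivative D x) (at x within S)"
    using ext[OF p] by blast
  have "e x = g x" if x: "x \<in> W" "x \<in> S" for x
  proof -
    have "x islimpt interior S"
    proof (cases "x \<in> interior S")
      case True
      then show ?thesis using interior_limit_point[of x "interior S"] by simp
    next
      case False
      then show ?thesis using x(2) S unfolding closure_def by blast
    qed
    then have nontriv: "at x within interior S \<noteq> bot"
      by (simp add: trivial_limit_within)
    have "(e \<longlongrightarrow> e x) (at x within S)"
      using has_derivative_continuous[OF e[OF x]] continuous_within by blast
    then have "(e \<longlongrightarrow> e x) (at x within interior S)"
      using tendsto_within_subset interior_subset by blast
    moreover have "\<forall>\<^sub>F y in at x within interior S. e y = f y"
      unfolding eventually_at_topological using W(1) x(1) ef by blast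
    ultimately have "(f \<longlongrightarrow> e x) (at x within interior S)"
      by (rule Lim_transform_eventually)
    then show ?thesis
      unfolding g_def by (rule tendsto_Lim[OF nontriv, symmetric])
  qed
  then have "(g has_derivative D p) (at p within S \<inter> W)"
    using has_derivative_transform[of p "S \<inter> W" g e] has_derivative_subset[OF e[OF W(2) p]] p W(2) by auto
  moreover have "at p within S \<inter> W = at p within S"
    by (rule at_within_nhd[OF W(2,1)]) auto
  ultimately show "(g has_derivative D p) (at p within S)"
    by simp
qed

lemma closed_field_has_potential_on_plane_domain:
  assumes S: "plane_domain S"
    and A: "continuous_on S A"
    and der: "\<And>p. p \<in> interior S \<Longrightarrow> (A has_derivative DA p) (at p)"
    and cont: "\<And>w. continuous_on (interior S) (\<lambda>p. DA p w)"
    and sym: "\<And>p v w. p \<in> interior S \<Longrightarrow> DA p v \<bullet> w = DA p w \<bullet> v"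
  shows "\<exists>f. \<forall>p\<in>S. (f has_derivative (\<lambda>w. A p \<bullet> w)) (at p within S)"
proof -
  have S': "compact S" "contractible S" "connected (interior S)" and cl: "S = closure (interior S)"
    using S unfolding plane_domain_def compact_eq_bounded_closed by blast+
  have "connected (- interior S)"
    using connected_complement_interior_contractible[OF S'(1,2)] by simp
  moreover have "bounded (interior S)"
    using S'(1) compact_imp_bounded bounded_interior by blast
  ultimately have "\<exists>f. \<forall>p\<in>interior S. (f has_derivative (\<lambda>w. A p \<bullet> w)) (at p)"
    by (intro closed_field_has_potential_plane[OF open_interior _ S'(3) _ der cont sym])
  then obtain f where f: "\<And>p. p \<in> interior S \<Longrightarrow> (f has_derivative (\<lambda>w. A p \<bullet> w)) (at p)"
    by blast
  show ?thesis
    by (rule glue_local_extensions[OF cl potential_extends_locally[OF S _ A f]])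
qed

section \<open>Equality of mixed partial derivatives\<close>

lemma second_difference_mean_value:
  fixes f :: "real \<times> real \<Rightarrow> real"
  assumes less: "x < x'" "y < y'"
    and f: "\<And>q. q \<in> cbox (x, y) (x', y') \<Longrightarrow>
      (f has_derivative (\<lambda>w. f1 q * fst w + f2 q * snd w)) (at q)"
    and f1: "\<And>q. q \<in> cbox (x, y) (x', y') \<Longrightarrow>
      (f1 has_derivative (\<lambda>w. f11 q * fst w + f12 q * snd w)) (at q)"
  shows "\<exists>q\<in>cbox (x, y) (x', y').
    f (x', y') - f (x, y') - f (x', y) + f (x, y) = (x' - x) * (y' - y) * f12 q"
proof -
  have "((\<lambda>s. f (s, y') - f (s, y)) has_real_derivative f1 (s, y') - f1 (s, y)) (at s)"
    if "x \<le> s" "s \<le> x'" for s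
  proof -
    have "((\<lambda>s. f (s, t)) has_real_derivative f1 (s, t)) (at s)" if t: "t \<in> {y..y'}" for t
    proof -
      have "((\<lambda>s. (s, t)) has_derivative (\<lambda>h. (h, 0))) (at s)"
        by (auto intro!: derivative_eq_intros)
      from has_derivative_compose[OF this f] show ?thesis
        using that t \<open>x \<le> s\<close> \<open>s \<le> x'\<close> by (simp add: has_field_derivative_def)
    qed
    from DERIV_diff[OF this[of y'] this[of y]] show ?thesis
      using less(2) by simp
  qed
  from MVT2[OF less(1) this] obtain s where s: "x < s" "s < x'"
    "(f (x', y') - f (x', y)) - (f (x, y') - f (x, y)) = (x' - x) * (f1 (s, y') - f1 (s, y))"
    by blast
  have "((\<lambda>t. f1 (s, t)) has_real_derivative f12 (s, t)) (at t)" if "y \<le> t" "t \<le> y'" for t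
  proof -
    have "((\<lambda>t. (s, t)) has_derivative (\<lambda>h. (0, h))) (at t)"
      by (auto intro!: derivative_eq_intros)
    from has_derivative_compose[OF this f1] show ?thesis
      using that s by (simp add: has_field_derivative_def)
  qed
  from MVT2[OF less(2) this] obtain t where t: "y < t" "t < y'"
    "f1 (s, y') - f1 (s, y) = (y' - y) * f12 (s, t)"
    by blast
  have "(s, t) \<in> cbox (x, y) (x', y')" using s t by simp
  moreover have "f (x', y') - f (x, y') - f (x', y) + f (x, y) = (x' - x) * (y' - y) * f12 (s, t)"
    using s(3) t(3) by (simp add: algebra_simps)
  ultimately show ?thesis by blast
qed

text \<open>
  The second difference of \<open>f\<close> over a small rectangle equals its area times a value of \<open>f12\<close>, and,
  after exchanging the coordinates, its area times a value of \<open>f21\<close>. Shrinking the rectangle to \<open>p\<close>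
  gives the claim by continuity.
\<close>

lemma mixed_partials_commute:
  fixes f :: "real \<times> real \<Rightarrow> real"
  assumes U: "open U" "p \<in> U"
    and f: "\<And>q. q \<in> U \<Longrightarrow> (f has_derivative (\<lambda>w. f1 q * fst w + f2 q * snd w)) (at q)"
    and f1: "\<And>q. q \<in> U \<Longrightarrow> (f1 has_derivative (\<lambda>w. f11 q * fst w + f12 q * snd w)) (at q)"
    and f2: "\<And>q. q \<in> U \<Longrightarrow> (f2 has_derivative (\<lambda>w. f21 q * fst w + f22 q * snd w)) (at q)"
    and cont: "continuous_on U f12" "continuous_on U f21"
  shows "f12 p = f21 p"
proof -
  have "\<bar>f12 p - f21 p\<bar> \<le> \<epsilon>" if "0 < \<epsilon>" for \<epsilon>
  proof -
    define N where "N = (U \<inter> f12 -` ball (f12 p) (\<epsilon>/2)) \<inter> (U \<inter> f21 -` ball (f21 p) (\<epsilon>/2))"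
    have "open N"
      unfolding N_def using cont U(1) by (intro open_Int continuous_open_preimage open_ball)
    moreover have "p \<in> N" using U(2) that by (simp add: N_def)
    ultimately obtain a b where ab: "cbox a b \<subseteq> N" "p \<in> box a b"
      by (rule open_contains_cbox)
    obtain x y x' y' where p: "p = (x, y)" and b: "b = (x', y')" by (metis surj_pair)
    have less: "x < x'" "y < y'" and sub: "cbox (x, y) (x', y') \<subseteq> N"
      using ab by (cases a; force simp: p b box_def cbox_def Basis_prod_def)+
    then have subU: "cbox (x, y) (x', y') \<subseteq> U" by (auto simp: N_def)
    obtain q where q: "q \<in> cbox (x, y) (x', y')"
      "f (x', y') - f (x, y') - f (x', y) + f (x, y) = (x' - x) * (y' - y) * f12 q"
      using second_difference_mean_value[OF less f f1] subU by blast
    have swap: "((\<lambda>q. h (prod.swap q)) has_derivative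
          (\<lambda>w. h2 (prod.swap q) * fst w + h1 (prod.swap q) * snd w)) (at q)"
      if "(h has_derivative
          (\<lambda>w. h1 (prod.swap q) * fst w + h2 (prod.swap q) * snd w)) (at (prod.swap q))"
      for h h1 h2 :: "real \<times> real \<Rightarrow> real" and q
    proof -
      have "(prod.swap has_derivative prod.swap) (at q)"
        unfolding prod.swap_def by (auto intro!: derivative_eq_intros)
      from has_derivative_compose[OF this that] show ?thesis
        by (simp add: add.commute)
    qed
    have swapU: "prod.swap q \<in> U" if "q \<in> cbox (y, x) (y', x')" for q
      using subU that by (cases q) auto
    have "((\<lambda>q. f (prod.swap q)) has_derivative
          (\<lambda>w. f2 (prod.swap q) * fst w + f1 (prod.swap q) * snd w)) (at q)"
        "((\<lambda>q. f2 (prod.swap q)) has_derivative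
          (\<lambda>w. f22 (prod.swap q) * fst w + f21 (prod.swap q) * snd w)) (at q)"
      if "q \<in> cbox (y, x) (y', x')" for q
      using swap[where h = f and ?h1.0 = f1 and ?h2.0 = f2, OF f[OF swapU[OF that]]]
        swap[where h = f2 and ?h1.0 = f21 and ?h2.0 = f22, OF f2[OF swapU[OF that]]]
      by blast+
    from second_difference_mean_value[OF less(2,1) this]
    have "\<exists>r\<in>cbox (y, x) (y', x'). f (x', y') - f (x', y) - f (x, y') + f (x, y) =
        (y' - y) * (x' - x) * f21 (prod.swap r)"
      by simp
    then obtain r where r: "r \<in> cbox (x, y) (x', y')"
      "f (x', y') - f (x', y) - f (x, y') + f (x, y) = (y' - y) * (x' - x) * f21 r"
      by force
    have "(x' - x) * (y' - y) * f12 q = (x' - x) * (y' - y) * f21 r"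
      using q(2) r(2) by (simp add: algebra_simps)
    then have "f12 q = f21 r" using less by simp
    moreover have "\<bar>f12 p - f12 q\<bar> < \<epsilon>/2" "\<bar>f21 p - f21 r\<bar> < \<epsilon>/2"
      using q(1) r(1) sub by (auto simp: N_def dist_real_def)
    ultimately show ?thesis by linarith
  qed
  then show ?thesis
    using field_le_epsilon[of "\<bar>f12 p - f21 p\<bar>" 0] by simp
qed

section \<open>Functions that agree on the domain\<close>

lemma has_derivative_within_cong:
  assumes "\<And>x. x \<in> S \<Longrightarrow> f x = g x" "p \<in> S"
  shows "(f has_derivative D) (at p within S) \<longleftrightarrow> (g has_derivative D) (at p within S)"
  using assms has_derivative_transform[of p S f g D] has_derivative_transform[of p S g f D] by auto

lemma frechet_derivative_within_cong:
  assumes "\<And>x. x \<in> S \<Longrightarrow> f x = g x" "p \<in> S"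
  shows "frechet_derivative f (at p within S) = frechet_derivative g (at p within S)"
  using has_derivative_within_cong[OF assms] by (simp add: frechet_derivative_def)

text \<open>
  Both sides choose from the same set of derivatives, which may be empty or have several elements.
\<close>

lemma frechet_derivative_add_const:
  "frechet_derivative (\<lambda>x. f x + c) F = frechet_derivative f F"
proof -
  have "((\<lambda>x. f x + c) has_derivative D) F \<longleftrightarrow> (f has_derivative D) F" for D
    using has_derivative_add_const[of f D F c] has_derivative_add_const[of "\<lambda>x. f x + c" D F "- c"] by auto
  then show ?thesis by (simp add: frechet_derivative_def)
qed

lemma partial_cong:
  assumes "\<And>x. x \<in> S \<Longrightarrow> f x = g x" "p \<in> S"
  shows "partial_x S f p = partial_x S g p" "partial_y S f p = partial_y S g p"
  unfolding partial_x_def partial_y_def using frechet_derivative_within_cong[OF assms] by simp_all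

lemma Ck_on_cong:
  assumes "\<And>x. x \<in> S \<Longrightarrow> f x = g x"
  shows "Ck_on k S f \<longleftrightarrow> Ck_on k S g"
  using assms
proof (induction k arbitrary: f g)
  case 0
  then show ?case by (simp cong: continuous_on_cong)
next
  case (Suc k)
  have "f differentiable (at p within S) \<longleftrightarrow> g differentiable (at p within S)" if "p \<in> S" for p
    using has_derivative_within_cong[OF Suc.prems that] by (simp add: differentiable_def)
  then have "f differentiable_on S \<longleftrightarrow> g differentiable_on S"
    by (simp add: differentiable_on_def)
  moreover have "Ck_on k S (partial_x S f) \<longleftrightarrow> Ck_on k S (partial_x S g)"
    "Ck_on k S (partial_y S f) \<longleftrightarrow> Ck_on k S (partial_y S g)"
    using partial_cong[OF Suc.prems] by (intro Suc.IH; simp)+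
  moreover have "continuous_on S f \<longleftrightarrow> continuous_on S g"
    using Suc.prems by (simp cong: continuous_on_cong)
  ultimately show ?case by simp
qed

lemma Ck_on_add_const:
  assumes "Ck_on k S f"
  shows "Ck_on k S (\<lambda>p. f p + c)"
proof (cases k)
  case 0
  then show ?thesis using assms by (auto intro!: continuous_intros)
next
  case (Suc m)
  have "partial_x S (\<lambda>p. f p + c) = partial_x S f" "partial_y S (\<lambda>p. f p + c) = partial_y S f"
    by (simp_all add: partial_x_def[abs_def] partial_y_def[abs_def] frechet_derivative_add_const)
  then show ?thesis
    using assms Suc by (auto intro!: continuous_intros simp: differentiable_on_def)
qed

lemma is_potential_solution_add_const:
  assumes f: "is_potential_solution S a u v f" and g: "\<And>p. p \<in> S \<Longrightarrow> g p = f p + c"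
  shows "is_potential_solution S a u v g"
proof -
  have px: "partial_x S g p = partial_x S f p" and py: "partial_y S g p = partial_y S f p" if "p \<in> S" for p
    using partial_cong[of S g "\<lambda>p. f p + c", OF g that]
    by (simp_all add: partial_x_def partial_y_def frechet_derivative_add_const)
  have pxx: "partial_x S (partial_x S g) p = partial_x S (partial_x S f) p"
    and pyy: "partial_y S (partial_y S g) p = partial_y S (partial_y S f) p" if "p \<in> S" for p
    by (rule partial_cong(1)[OF px that] partial_cong(2)[OF py that]; assumption)+
  have "Ck_on 2 S g"
    using f Ck_on_cong[of S g "\<lambda>p. f p + c", OF g] Ck_on_add_const by (auto simp: is_potential_solution_def)
  moreover have "second_order_equation S a g \<longleftrightarrow> second_order_equation S a f"
    unfolding second_order_equation_def by (intro ball_cong refl) (auto simp: px pxx pyy)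
  ultimately show ?thesis
    using f px py by (simp add: is_potential_solution_def)
qed

section \<open>The system and the second-order equation\<close>

lemma potential_solution_has_derivative:
  assumes "is_potential_solution S a u v f" "p \<in> S"
  shows "(f has_derivative (\<lambda>w. (v p, u p) \<bullet> w)) (at p within S)"
proof -
  have "f differentiable (at p within S)"
    using assms by (auto simp: is_potential_solution_def numeral_2_eq_2 differentiable_on_def)
  from partials_has_derivative[OF this] show ?thesis
    using assms by (simp add: is_potential_solution_def)
qed

text \<open>
  The difference has derivative zero on the connected interior, hence is constant there, and by
  continuity on its closure \<open>S\<close>.
\<close>

lemma potential_solutions_differ_by_const:
  assumes S: "plane_domain S"
    and f: "is_potential_solution S a u v f" and g: "is_potential_solution S a u v g"
  shows "\<exists>c. \<forall>p\<in>S. g p = f p + c"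
proof -
  have cl: "S = closure (interior S)" and con: "connected (interior S)" and "S \<noteq> {}"
    using S unfolding plane_domain_def by blast+
  then have "interior S \<noteq> {}"
    by (metis closure_empty)
  then obtain p0 where p0: "p0 \<in> interior S"
    by blast
  have der: "((\<lambda>p. g p - f p) has_derivative (\<lambda>w. 0)) (at p within S)" if "p \<in> S" for p
    using has_derivative_diff[OF potential_solution_has_derivative[OF g that]
        potential_solution_has_derivative[OF f that]] by simp
  have const: "g p - f p = g p0 - f p0" if "p \<in> interior S" for p
  proof (rule has_derivative_zero_unique_connected[OF open_interior con _ that p0])
    show "((\<lambda>p. g p - f p) has_derivative (\<lambda>w. 0)) (at x)" if "x \<in> interior S" for x
      using der[of x] that at_within_interior[OF that] interior_subset by force
  qed
  have "continuous_on S (\<lambda>p. g p - f p)"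
    unfolding continuous_on_eq_continuous_within using der has_derivative_continuous by blast
  then have cont: "continuous_on (closure (interior S)) (\<lambda>p. g p - f p)"
    unfolding cl[symmetric] .
  have "g p - f p = g p0 - f p0" if "p \<in> S" for p
    by (rule continuous_constant_on_closure[OF cont const]) (use that cl in blast)+
  then show ?thesis by (intro exI[of _ "g p0 - f p0"]) (auto simp: algebra_simps)
qed

lemma first_order_system_has_potential:
  assumes S: "plane_domain S" and a: "a \<noteq> 0"
    and u: "Ck_on 1 S u" and v: "Ck_on 1 S v" and uv: "first_order_system S a u v"
  shows "\<exists>f. is_potential_solution S a u v f"
proof -
  have du: "u differentiable (at p within S)" and dv: "v differentiable (at p within S)" if "p \<in> S" for p
    using u v that by (auto simp: differentiable_on_def)
  define DA where "DA = (\<lambda>p w. ((partial_x S v p, partial_y S v p) \<bullet> w, (partial_x S u p, partial_y S u p) \<bullet> w))"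
  have "\<exists>f. \<forall>p\<in>S. (f has_derivative (\<lambda>w. (v p, u p) \<bullet> w)) (at p within S)"
  proof (rule closed_field_has_potential_on_plane_domain[OF S])
    show "continuous_on S (\<lambda>p. (v p, u p))"
      using u v by (auto intro!: continuous_intros)
    fix p assume p: "p \<in> interior S"
    then have pS: "p \<in> S" using interior_subset by blast
    have "((\<lambda>p. (v p, u p)) has_derivative DA p) (at p within S)"
      unfolding DA_def by (intro has_derivative_Pair partials_has_derivative du dv pS)
    then show "((\<lambda>p. (v p, u p)) has_derivative DA p) (at p)"
      using at_within_interior[OF p] by simp
    have "partial_x S u p = partial_y S v p"
      using uv pS by (cases p) (auto simp: first_order_system_def)
    then show "DA p w \<bullet> w' = DA p w' \<bullet> w" for w w'
      by (simp add: DA_def inner_prod_def algebra_simps)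
  next
    fix w
    have "continuous_on S (partial_x S v)" "continuous_on S (partial_y S v)"
      "continuous_on S (partial_x S u)" "continuous_on S (partial_y S u)"
      using u v by auto
    then have "continuous_on S (\<lambda>p. DA p w)"
      unfolding DA_def by (intro continuous_intros)
    then show "continuous_on (interior S) (\<lambda>p. DA p w)"
      using continuous_on_subset interior_subset by blast
  qed
  then obtain f where f: "\<And>p. p \<in> S \<Longrightarrow> (f has_derivative (\<lambda>w. (v p, u p) \<bullet> w)) (at p within S)"
    by blast
  have df: "f differentiable (at p within S)" if "p \<in> S" for p
    using f[OF that] differentiableI by blast
  have "partial_x S f p = v p \<and> partial_y S f p = u p" if p: "p \<in> S" for p
  proof -
    have "(\<lambda>w. (partial_x S f p, partial_y S f p) \<bullet> w) = (\<lambda>w. (v p, u p) \<bullet> w)"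
      by (rule has_derivative_within_plane_domain_unique[OF S p partials_has_derivative[OF df[OF p]] f[OF p]])
    from fun_cong[OF this, of "(1, 0)"] fun_cong[OF this, of "(0, 1)"] show ?thesis
      by simp
  qed
  then have px: "partial_x S f p = v p" and py: "partial_y S f p = u p" if "p \<in> S" for p
    using that by blast+
  have "Ck_on 1 S (partial_x S f)" "Ck_on 1 S (partial_y S f)"
    using u v Ck_on_cong[of S "partial_x S f" v 1, OF px] Ck_on_cong[of S "partial_y S f" u 1, OF py]
    by blast+
  moreover have diff: "f differentiable_on S"
    using df by (simp add: differentiable_on_def)
  moreover have "continuous_on S f"
    by (rule differentiable_imp_continuous_on[OF diff])
  ultimately have "Ck_on 2 S f"
    by (simp add: numeral_2_eq_2)
  moreover have "second_order_equation S a f"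
    unfolding second_order_equation_def
  proof (clarify)
    fix x y assume p: "(x, y) \<in> S"
    define W where "W = (v (x, y))\<^sup>2 + y\<^sup>2 + a\<^sup>2"
    have "0 < W" using a by (simp add: W_def add_nonneg_pos)
    then have W: "W powr (-1/2) * W powr (1/2) = 1"
      by (simp add: powr_add[symmetric])
    have "partial_x S (partial_x S f) (x, y) = - 2 * W powr (1/2) * partial_y S u (x, y)"
      using partial_cong(1)[OF px p] uv p by (auto simp: first_order_system_def W_def)
    moreover have "partial_y S (partial_y S f) (x, y) = partial_y S u (x, y)"
      by (rule partial_cong(2)[OF py p])
    moreover have "r * (- 2 * s * d) + 2 * d = 0" if "r * s = 1" for r s d :: real
      using that by algebra
    note this[OF W, of "partial_y S u (x, y)"]
    ultimately show "((partial_x S f (x, y))\<^sup>2 + y\<^sup>2 + a\<^sup>2) powr (-1/2) * partial_x S (partial_x S f) (x, y)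
        + 2 * partial_y S (partial_y S f) (x, y) = 0"
      by (simp only: px[OF p] W_def[symmetric])
  qed
  ultimately show ?thesis
    using px py by (auto simp: is_potential_solution_def)
qed

text \<open>
  In the interior this is the usual symmetry of second derivatives; both sides are continuous on
  \<open>S = closure (interior S)\<close>.
\<close>

lemma mixed_partials_commute_on_plane_domain:
  assumes S: "plane_domain S" and f: "Ck_on 2 S f" and p: "p \<in> S"
  shows "partial_x S (partial_y S f) p = partial_y S (partial_x S f) p"
proof -
  let ?v = "partial_x S f" and ?u = "partial_y S f"
  have cl: "S = closure (interior S)"
    using S unfolding plane_domain_def by blast
  have diff: "f differentiable_on S" "?v differentiable_on S" "?u differentiable_on S"
    and cont: "continuous_on S (partial_y S ?v)" "continuous_on S (partial_x S ?u)"
    using f by (auto simp: numeral_2_eq_2)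
  have der: "(h has_derivative (\<lambda>w. partial_x S h q * fst w + partial_y S h q * snd w)) (at q)"
    if "h differentiable_on S" "q \<in> interior S" for h q
  proof -
    have "q \<in> S" using that(2) interior_subset by blast
    then have "h differentiable (at q within S)"
      using that(1) by (simp add: differentiable_on_def)
    from partials_has_derivative[OF this] show ?thesis
      by (simp add: at_within_interior[OF that(2)] inner_prod_def)
  qed
  have "partial_y S ?v q - partial_x S ?u q = 0" if q: "q \<in> interior S" for q
    using mixed_partials_commute[OF open_interior q der[OF diff(1)] der[OF diff(2)] der[OF diff(3)]
        continuous_on_subset[OF cont(1) interior_subset] continuous_on_subset[OF cont(2) interior_subset]]
    by simp
  note zero = this
  have "continuous_on (closure (interior S)) (\<lambda>q. partial_y S ?v q - partial_x S ?u q)"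
    unfolding cl[symmetric] by (intro continuous_intros cont)
  from continuous_constant_on_closure[OF this zero] have "partial_y S ?v p - partial_x S ?u p = 0"
    using p cl by blast
  then show ?thesis by simp
qed

lemma second_order_equation_imp_first_order_system:
  assumes S: "plane_domain S" and a: "a \<noteq> 0"
    and f: "Ck_on 2 S f" and eq: "second_order_equation S a f"
  shows "first_order_system S a (partial_y S f) (partial_x S f)"
  unfolding first_order_system_def
proof (clarify, intro conjI)
  fix x y assume p: "(x, y) \<in> S"
  show "partial_x S (partial_y S f) (x, y) = partial_y S (partial_x S f) (x, y)"
    by (rule mixed_partials_commute_on_plane_domain[OF S f p])
  define W where "W = (partial_x S f (x, y))\<^sup>2 + y\<^sup>2 + a\<^sup>2"
  have "0 < W" using a by (simp add: W_def add_nonneg_pos)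
  then have W: "W powr (1/2) * W powr (-1/2) = 1"
    by (simp add: powr_add[symmetric])
  have "W powr (-1/2) * partial_x S (partial_x S f) (x, y) + 2 * partial_y S (partial_y S f) (x, y) = 0"
    using eq p by (auto simp: second_order_equation_def W_def)
  moreover have "X = - 2 * s * d" if "s * r = 1" "r * X + 2 * d = 0" for r s d X :: real
    using that by algebra
  note this[OF W]
  ultimately show "partial_x S (partial_x S f) (x, y) =
      - 2 * ((partial_x S f (x, y))\<^sup>2 + y\<^sup>2 + a\<^sup>2) powr (1/2) * partial_y S (partial_y S f) (x, y)"
    unfolding W_def[symmetric] by blast
qed

theorem proposition7p1:
  fixes S :: "(real \<times> real) set" and a :: real
  assumes "plane_domain S" and "a \<noteq> 0"
  shows "(\<forall>u v. Ck_on 1 S u \<and> Ck_on 1 S v \<and> first_order_system S a u v \<longrightarrow>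
            (\<exists>f. is_potential_solution S a u v f \<and>
                 (\<forall>g. is_potential_solution S a u v g \<longleftrightarrow> (\<exists>c. \<forall>p\<in>S. g p = f p + c)))) \<and>
         (\<forall>f. Ck_on 2 S f \<and> second_order_equation S a f \<longrightarrow>
            Ck_on 1 S (partial_y S f) \<and> Ck_on 1 S (partial_x S f) \<and>
            first_order_system S a (partial_y S f) (partial_x S f))"
proof (intro conjI allI impI)
  fix u v
  assume uv: "Ck_on 1 S u \<and> Ck_on 1 S v \<and> first_order_system S a u v"
  then obtain f where f: "is_potential_solution S a u v f"
    using first_order_system_has_potential[OF assms] by blast
  show "\<exists>f. is_potential_solution S a u v f \<and>
      (\<forall>g. is_potential_solution S a u v g \<longleftrightarrow> (\<exists>c. \<forall>p\<in>S. g p = f p + c))"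
    using f potential_solutions_differ_by_const[OF assms(1) f] is_potential_solution_add_const[OF f]
    by (intro exI[of _ f]) blast
next
  fix f
  assume f: "Ck_on 2 S f \<and> second_order_equation S a f"
  then show "Ck_on 1 S (partial_y S f)" "Ck_on 1 S (partial_x S f)"
    by (simp_all add: numeral_2_eq_2)
  show "first_order_system S a (partial_y S f) (partial_x S f)"
    using second_order_equation_imp_first_order_system[OF assms] f by blast
qed

end
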